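(* Let $m\ge 1$, let $\theta\mapsto V(\theta)$ be a differentiable function of a real parameter $\theta$ (in an open interval) whose values are complex covariance matrices of $m$-mode Gaussian states, and let $\mathcal A=\mathcal A(\theta)=X\left(\mathbb 1-(V(\theta)+\mathbb 1/2)^{-1}\right)\in\mathbb C^{2m\times 2m}$, a complex symmetric matrix. Let $P_{\mathcal A}(\bar n)=\frac{1}{\mathcal Z}\frac{\mathrm{Haf}(\mathcal A_{\bar n\oplus\bar n})}{n_1!\cdots n_m!}$ with $\frac1{\mathcal Z}=\sqrt{\det(\mathbb 1-X\mathcal A)}$. Then for every $\bar n=(n_1,\dots,n_m)\in\mathbb Z_{\ge0}^m$, with $N=\sum_k n_k$, $$\partial_\theta P_{\mathcal A}(\bar n)=-\frac12\operatorname{Tr}\left[(X-\mathcal A)^{-1}\,\partial_\theta\mathcal A\right]P_{\mathcal A}(\bar n)+\frac{1}{\mathcal Z}\,\frac{1}{n_1!\cdots n_m!}\cdot\frac12\sum_{\substack{i,j=1\\ i\neq j}}^{2N}\left(\partial_\theta\mathcal A_{\bar n\oplus\bar n}\right)_{ij}\,\mathrm{Haf}\left(\mathcal A^{[i,j]}_{\bar n\oplus\bar n}\right),$$ where the sum runs over ordered pairs $(i,j)$ of distinct indices.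
   Context: $X=\begin{pmatrix}0&\mathbb 1_m\\ \mathbb 1_m&0\end{pmatrix}$. A complex covariance matrix of an $m$-mode Gaussian state is a Hermitian $2m\times2m$ matrix $V$ of the form $V=\begin{pmatrix}\Gamma&\Delta\\ \Delta^*&\Gamma^*\end{pmatrix}$ ($\Gamma$ Hermitian, $\Delta$ symmetric, $*$ entrywise conjugation; equivalently $V$ Hermitian and $XVX=V^*$) satisfying the uncertainty relation $V+\frac12 Z\ge0$ with $Z=\begin{pmatrix}\mathbb 1_m&0\\0&-\mathbb 1_m\end{pmatrix}$. For a symmetric matrix $B$ of even size $2r$, $\mathrm{Haf}(B)=\sum_{\mu}\prod_{\{i,j\}\in\mu}B_{ij}$, the sum running over all partitions $\mu$ of $\{1,\dots,2r\}$ into two-element subsets; the hafnian of the empty ($0\times0$) matrix is $1$. For a $p\times p$ matrix $B$ and $\bar k\in\mathbb Z_{\ge0}^p$, $B_{\bar k}$ is obtained by repeating the $i$-th row and column of $B$ exactly $k_i$ times (deleting them if $k_i=0$). Here $\bar n\oplus\bar n=(n_1,\dots,n_m,n_1,\dots,n_m)$, so $\mathcal A_{\bar n\oplus\bar n}$ is $2N\times2N$. The matrix $\mathcal A^{[i,j]}_{\bar n\oplus\bar n}$ is $\mathcal A_{\bar n\oplus\bar n}$ with rows $i,j$ and columns $i,j$ removed. *)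

theory Defs
  imports "HOL-Analysis.Analysis" "HOL-Library.Disjoint_Sets"
begin

text \<open>The modes are the elements of a finite type \<open>'m\<close> (so \<open>m = CARD('m) \<ge> 1\<close>), and
  \<open>2m \<times> 2m\<close> matrices are indexed by the disjoint sum \<open>'m + 'm\<close>.\<close>

definition block_mat ::
  "'a^'m^'m \<Rightarrow> 'a^'m^'m \<Rightarrow> 'a^'m^'m \<Rightarrow> 'a^'m^'m \<Rightarrow> 'a^('m + 'm)^('m::finite + 'm)" where
  "block_mat A B C D = (\<chi> i j.
     case i of
       Inl a \<Rightarrow> (case j of Inl b \<Rightarrow> A $ a $ b | Inr b \<Rightarrow> B $ a $ b)
     | Inr a \<Rightarrow> (case j of Inl b \<Rightarrow> C $ a $ b | Inr b \<Rightarrow> D $ a $ b))"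

definition X_mat :: "complex^('m + 'm)^('m::finite + 'm)" where
  "X_mat = block_mat 0 (mat 1) (mat 1) 0"

definition Z_mat :: "complex^('m + 'm)^('m::finite + 'm)" where
  "Z_mat = block_mat (mat 1) 0 0 (- mat 1)"

definition conj_mat :: "complex^'n^'m \<Rightarrow> complex^'n^'m" where
  "conj_mat A = (\<chi> i j. cnj (A $ i $ j))"

definition hermitian_mat :: "complex^'n^'n \<Rightarrow> bool" where
  "hermitian_mat A \<longleftrightarrow> transpose (conj_mat A) = A"

definition psd_mat :: "complex^'n^'n \<Rightarrow> bool" where
  "psd_mat A \<longleftrightarrow> hermitian_mat A \<and>
     (\<forall>v. 0 \<le> Re (\<Sum>i\<in>UNIV. cnj (v $ i) * (A *v v) $ i))"

definition complex_covariance :: "complex^('m + 'm)^('m::finite + 'm) \<Rightarrow> bool" where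
  "complex_covariance V \<longleftrightarrow>
     (\<exists>\<Gamma> \<Delta>. hermitian_mat \<Gamma> \<and> transpose \<Delta> = \<Delta> \<and>
        V = block_mat \<Gamma> \<Delta> (conj_mat \<Delta>) (conj_mat \<Gamma>)) \<and>
     psd_mat (V + (1/2) *\<^sub>R Z_mat)"

definition adjacency_mat ::
  "complex^('m + 'm)^('m::finite + 'm) \<Rightarrow> complex^('m + 'm)^('m + 'm)" where
  "adjacency_mat V = X_mat ** (mat 1 - matrix_inv (V + (1/2) *\<^sub>R mat 1))"

text \<open>A matrix of size \<open>card S\<close> is given by a function \<open>B\<close> of two indices together with its finite
  index set \<open>S\<close>; deleting rows and columns means shrinking \<open>S\<close>. No order on \<open>S\<close> is needed, since
  the hafnian only depends on unordered partitions.

  The entry belonging to an unordered pair is well defined when \<open>B\<close> is symmetric,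
  which is the only case in which the hafnian is used.\<close>

definition pair_entry :: "('i \<Rightarrow> 'i \<Rightarrow> 'a) \<Rightarrow> 'i set \<Rightarrow> 'a" where
  "pair_entry B e = (THE z. \<exists>i j. e = {i, j} \<and> z = B i j)"

lemma pair_entry_doubleton:
  assumes "B i j = B j i"
  shows "pair_entry B {i, j} = B i j"
  unfolding pair_entry_def
  by (rule the_equality) (use assms in \<open>auto simp: doubleton_eq_iff\<close>)

definition pairings :: "'i set \<Rightarrow> 'i set set set" where
  "pairings S = {\<mu>. partition_on S \<mu> \<and> (\<forall>e\<in>\<mu>. card e = 2)}"

definition hafnian :: "'i set \<Rightarrow> ('i \<Rightarrow> 'i \<Rightarrow> 'a::comm_semiring_1) \<Rightarrow> 'a" where
  "hafnian S B = (\<Sum>\<mu>\<in>pairings S. \<Prod>e\<in>\<mu>. pair_entry B e)"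

lemma hafnian_empty: "hafnian {} (B :: 'i \<Rightarrow> 'i \<Rightarrow> 'a::comm_semiring_1) = 1"
proof -
  have "pairings ({} :: 'i set) = {{}}"
    by (auto simp: pairings_def partition_on_def)
  then show ?thesis
    by (simp add: hafnian_def)
qed

text \<open>The matrix \<open>B\<^sub>k\<close>: its index set consists of the copies \<open>(i, c)\<close>, \<open>c < k i\<close>, of the
  indices \<open>i\<close> of \<open>B\<close>, and its entries ignore the copy number.\<close>

definition rep_index :: "('i \<Rightarrow> nat) \<Rightarrow> ('i \<times> nat) set" where
  "rep_index k = (SIGMA i:UNIV. {..<k i})"

definition rep_mat :: "'a^'i^'i \<Rightarrow> 'i \<times> nat \<Rightarrow> 'i \<times> nat \<Rightarrow> 'a" where
  "rep_mat B p q = B $ fst p $ fst q"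

definition double :: "('m \<Rightarrow> nat) \<Rightarrow> 'm + 'm \<Rightarrow> nat" where
  "double n = case_sum n n"

lemma card_rep_index_double:
  fixes n :: "'m::finite \<Rightarrow> nat"
  shows "card (rep_index (double n)) = 2 * (\<Sum>k\<in>UNIV. n k)"
  by (simp add: rep_index_def double_def UNIV_Plus_UNIV[symmetric] sum.Plus
           del: UNIV_Plus_UNIV)

text \<open>For \<open>A = adjacency_mat V\<close> with \<open>V\<close> a covariance matrix, the determinant below equals
  \<open>1 / det (V + 1/2)\<close>, a positive real, so \<^const>\<open>csqrt\<close> is the usual positive root.\<close>

definition inv_norm :: "complex^('m + 'm)^('m::finite + 'm) \<Rightarrow> complex" where
  "inv_norm A = csqrt (det (mat 1 - X_mat ** A))"

definition photon_prob ::
  "complex^('m + 'm)^('m::finite + 'm) \<Rightarrow> ('m \<Rightarrow> nat) \<Rightarrow> complex" where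
  "photon_prob A n =
     inv_norm A * (hafnian (rep_index (double n)) (rep_mat A) / (\<Prod>k\<in>UNIV. fact (n k)))"

end

theory Submission
  imports Defs
begin

text \<open>Write \<open>Q = V + 1/2\<close>, so that \<open>1 - X\<A> = Q\<^sup>-\<^sup>1\<close>. Conjugating the uncertainty relation
  by \<open>X\<close> turns \<open>V + Z/2 \<ge> 0\<close> into \<open>V - Z/2 \<ge> 0\<close>; averaging gives \<open>V \<ge> 0\<close>, hence \<open>Q > 0\<close> and
  \<open>det (1 - X\<A>) > 0\<close>. So \<open>1/\<Z>\<close> is differentiable, and Jacobi's formula together with
  \<open>(1 - X\<A>)\<^sup>-\<^sup>1 = (X - \<A>)\<^sup>-\<^sup>1 X\<close> yields the trace term. For the hafnian, the product rule
  marks one pair \<open>e\<close> in each pairing, and the pairings of \<open>S\<close> containing \<open>e\<close> are the pairings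
  of \<open>S - e\<close>; the factor \<open>1/2\<close> comes from counting ordered pairs.\<close>

section \<open>Pairings of a finite set and the derivative of the hafnian\<close>

lemma finite_pairings: "finite S \<Longrightarrow> finite (pairings S)"
  by (rule finite_subset[OF _ finitely_many_partition_on[of S]]) (auto simp: pairings_def)

text \<open>The inverse map is \<open>insert e\<close>. Since \<open>e\<close> is nonempty and
  disjoint from \<open>S - e\<close>, it is never a block of a pairing of \<open>S - e\<close>, so
  inserting and then removing it changes nothing.\<close>

lemma bij_betw_pairings_containing:
  assumes "e \<subseteq> S" "card e = 2"
  shows "bij_betw (\<lambda>\<mu>. \<mu> - {e}) {\<mu> \<in> pairings S. e \<in> \<mu>} (pairings (S - e))"
proof (rule bij_betw_byWitness[where f' = "insert e"])
  have ne: "e \<noteq> {}" using assms by auto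
  have notin: "e \<notin> \<mu>" "disjnt e (\<Union>\<mu>)" if "\<mu> \<in> pairings (S - e)" for \<mu>
    using that ne by (auto simp: pairings_def partition_on_def disjnt_iff)
  show "\<forall>\<mu>\<in>{\<mu> \<in> pairings S. e \<in> \<mu>}. insert e (\<mu> - {e}) = \<mu>" by auto
  show "\<forall>\<mu>\<in>pairings (S - e). insert e \<mu> - {e} = \<mu>"
    using notin by auto
  show "(\<lambda>\<mu>. \<mu> - {e}) ` {\<mu> \<in> pairings S. e \<in> \<mu>} \<subseteq> pairings (S - e)"
  proof safe
    fix \<mu> assume \<mu>: "\<mu> \<in> pairings S" "e \<in> \<mu>"
    have "disjnt e (\<Union>(\<mu> - {e}))"
      using \<mu> by (fastforce simp: pairings_def partition_on_def disjoint_def disjnt_def)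
    moreover have "insert e (\<mu> - {e}) = \<mu>" using \<mu> by auto
    ultimately show "\<mu> - {e} \<in> pairings (S - e)"
      using \<mu> partition_on_insert[of e "\<mu> - {e}" S] by (auto simp: pairings_def)
  qed
  show "insert e ` pairings (S - e) \<subseteq> {\<mu> \<in> pairings S. e \<in> \<mu>}"
    using notin assms ne by (auto simp: pairings_def partition_on_insert)
qed

text \<open>Group the ordered pairs by the map \<open>(i, j)\<close> to \<open>{i, j}\<close>: the
  fibre over each two-element set \<open>{a, b}\<close> is exactly \<open>(a, b)\<close> and
  \<open>(b, a)\<close>.\<close>

lemma sum_over_pairs:
  fixes f :: "'i set \<Rightarrow> 'a::field_char_0"
  assumes "finite S"
  shows "(\<Sum>e | e \<subseteq> S \<and> card e = 2. f e) = (1/2) * (\<Sum>(i, j) | i \<in> S \<and> j \<in> S \<and> i \<noteq> j. f {i, j})"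
proof -
  let ?P = "{(i, j). i \<in> S \<and> j \<in> S \<and> i \<noteq> j}" and ?E = "{e. e \<subseteq> S \<and> card e = 2}"
  have fin: "finite ?P" "finite ?E"
    using assms by (auto intro: finite_subset[of _ "S \<times> S"])
  have fib: "(\<Sum>p | p \<in> ?P \<and> (case p of (i, j) \<Rightarrow> {i, j}) = e. (case p of (i, j) \<Rightarrow> f {i, j})) = 2 * f e"
    if "e \<in> ?E" for e
  proof -
    obtain a b where ab: "e = {a, b}" "a \<noteq> b"
      using \<open>e \<in> ?E\<close> by (auto simp: card_2_iff)
    have "{p. p \<in> ?P \<and> (case p of (i, j) \<Rightarrow> {i, j}) = e} = {(a, b), (b, a)}"
      using ab \<open>e \<in> ?E\<close> by (auto simp: doubleton_eq_iff)
    then show ?thesis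
      using ab by (simp add: insert_commute)
  qed
  have "(\<Sum>p\<in>?P. (case p of (i, j) \<Rightarrow> f {i, j})) =
     (\<Sum>e\<in>?E. \<Sum>p | p \<in> ?P \<and> (case p of (i, j) \<Rightarrow> {i, j}) = e. (case p of (i, j) \<Rightarrow> f {i, j}))"
    by (rule sum.group[symmetric]) (use fin in \<open>auto\<close>)
  also have "\<dots> = (\<Sum>e\<in>?E. 2 * f e)"
    by (rule sum.cong[OF refl fib])
  finally show ?thesis
    by (simp add: sum_distrib_left[symmetric])
qed

lemma has_vector_derivative_prod:
  fixes f :: "'i \<Rightarrow> real \<Rightarrow> 'a::real_normed_field"
  assumes "\<And>i. i \<in> I \<Longrightarrow> (f i has_vector_derivative f' i) (at x within S)"
  shows "((\<lambda>t. \<Prod>i\<in>I. f i t) has_vector_derivative (\<Sum>i\<in>I. f' i * (\<Prod>j\<in>I - {i}. f j x))) (at x within S)"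
  using has_derivative_prod[of I f "\<lambda>i h. h *\<^sub>R f' i" x S] assms
  by (simp add: has_vector_derivative_def scaleR_sum_right)

text \<open>Symmetry is asked for on the neighbourhood \<open>I\<close> of \<open>x\<close>, because
  differentiating \<open>pair_entry (B t) {i, j}\<close> requires that it agree with
  \<open>B t i j\<close> for all \<open>t\<close> near \<open>x\<close>.\<close>

lemma hafnian_has_vector_derivative:
  fixes B :: "real \<Rightarrow> 'i \<Rightarrow> 'i \<Rightarrow> 'a::{real_normed_field}"
  assumes "finite S" "open I" "x \<in> I"
    and sym: "\<And>t i j. t \<in> I \<Longrightarrow> B t i j = B t j i"
    and der: "\<And>i j. i \<in> S \<Longrightarrow> j \<in> S \<Longrightarrow> ((\<lambda>t. B t i j) has_vector_derivative B' i j) (at x)"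
  shows "((\<lambda>t. hafnian S (B t)) has_vector_derivative
      (1/2) * (\<Sum>(i, j) | i \<in> S \<and> j \<in> S \<and> i \<noteq> j. B' i j * hafnian (S - {i, j}) (B x))) (at x)"
proof -
  \<comment> \<open>\<open>B'\<close> is indexed by ordered pairs, whereas the product rule needs
    one derivative for each unordered pair. Uniqueness of derivatives identifies
    \<open>D {i, j}\<close> with \<open>B' i j\<close>.\<close>
  define D where "D e = vector_derivative (\<lambda>t. pair_entry (B t) e) (at x)" for e
  have dpair: "((\<lambda>t. pair_entry (B t) {i, j}) has_vector_derivative B' i j) (at x)"
    if "i \<in> S" "j \<in> S" for i j
    by (rule has_vector_derivative_transform_within_open[OF der[OF that] assms(2,3)])
       (simp add: pair_entry_doubleton sym)
  have D: "D {i, j} = B' i j" if "i \<in> S" "j \<in> S" for i j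
    unfolding D_def using vector_derivative_at[OF dpair[OF that]] .
  have dD: "((\<lambda>t. pair_entry (B t) e) has_vector_derivative D e) (at x)" if "e \<subseteq> S" "card e = 2" for e
    using that dpair D by (auto simp: card_2_iff)
  let ?p = "\<lambda>e. pair_entry (B x) e"
  have elem: "e \<subseteq> S \<and> card e = 2" if "\<mu> \<in> pairings S" "e \<in> \<mu>" for e \<mu>
    using that by (auto simp: pairings_def partition_on_def)
  have "((\<lambda>t. hafnian S (B t)) has_vector_derivative
      (\<Sum>\<mu>\<in>pairings S. \<Sum>e\<in>\<mu>. D e * (\<Prod>e'\<in>\<mu> - {e}. ?p e'))) (at x)"
    unfolding hafnian_def
    by (intro has_vector_derivative_sum has_vector_derivative_prod dD) (use elem in auto)
  \<comment> \<open>Let \<open>e\<close> range over a set that does not depend on \<mu>, with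
    membership in \<mu> as a side condition, so that the two sums can be exchanged.\<close>
  also have "(\<Sum>\<mu>\<in>pairings S. \<Sum>e\<in>\<mu>. D e * (\<Prod>e'\<in>\<mu> - {e}. ?p e')) =
     (\<Sum>\<mu>\<in>pairings S. \<Sum>e | e \<in> {e. e \<subseteq> S \<and> card e = 2} \<and> e \<in> \<mu>. D e * (\<Prod>e'\<in>\<mu> - {e}. ?p e'))"
    using elem by (intro sum.cong) auto
  also have "\<dots> = (\<Sum>e | e \<subseteq> S \<and> card e = 2. \<Sum>\<mu> | \<mu> \<in> pairings S \<and> e \<in> \<mu>. D e * (\<Prod>e'\<in>\<mu> - {e}. ?p e'))"
    by (rule sum.swap_restrict) (use assms(1) finite_pairings in auto)
  also have "\<dots> = (\<Sum>e | e \<subseteq> S \<and> card e = 2. D e * hafnian (S - e) (B x))"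
  proof (rule sum.cong[OF refl])
    fix e assume "e \<in> {e. e \<subseteq> S \<and> card e = 2}"
    then have e: "e \<subseteq> S" "card e = 2" by auto
    show "(\<Sum>\<mu> | \<mu> \<in> pairings S \<and> e \<in> \<mu>. D e * (\<Prod>e'\<in>\<mu> - {e}. ?p e')) = D e * hafnian (S - e) (B x)"
      using sum.reindex_bij_betw[OF bij_betw_pairings_containing[OF e], of "\<lambda>\<mu>. D e * (\<Prod>e'\<in>\<mu>. ?p e')"]
      by (simp add: hafnian_def sum_distrib_left)
  qed
  also have "\<dots> = (1/2) * (\<Sum>(i, j) | i \<in> S \<and> j \<in> S \<and> i \<noteq> j. D {i, j} * hafnian (S - {i, j}) (B x))"
    by (rule sum_over_pairs[OF assms(1)])
  also have "(\<Sum>(i, j) | i \<in> S \<and> j \<in> S \<and> i \<noteq> j. D {i, j} * hafnian (S - {i, j}) (B x)) =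
      (\<Sum>(i, j) | i \<in> S \<and> j \<in> S \<and> i \<noteq> j. B' i j * hafnian (S - {i, j}) (B x))"
    by (rule sum.cong) (auto simp: D)
  finally show ?thesis .
qed

section \<open>Inverse matrices and Cramer's rule\<close>

lemma matrix_inv_right: "invertible A \<Longrightarrow> A ** matrix_inv A = mat 1"
  and matrix_inv_left: "invertible A \<Longrightarrow> matrix_inv A ** A = mat 1"
  unfolding invertible_def matrix_inv_def by (metis (mono_tags, lifting) someI_ex)+

lemma matrix_inv_unique:
  assumes "A ** B = mat 1" "B ** A = mat 1"
  shows "matrix_inv A = B"
proof -
  have "invertible A" using assms by (auto simp: invertible_def)
  then have "matrix_inv A ** (A ** B) = B"
    by (simp add: matrix_mul_assoc matrix_inv_left)
  with assms show ?thesis by simp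
qed

text \<open>Column \<open>l\<close> of the inverse solves \<open>A *v x = column l (mat 1)\<close>,
  and Cramer's rule gives its entries. Entries of the inverse thus become quotients of determinants,
  which can be differentiated.\<close>

lemma matrix_inv_cramer:
  fixes A :: "'a::field^'n^'n"
  assumes "det A \<noteq> 0"
  shows "matrix_inv A $ k $ l = det (\<chi> i j. if j = k then mat 1 $ i $ l else A $ i $ j) / det A"
proof -
  have "invertible A" using assms by (simp add: invertible_det_nz)
  have "A *v column l (matrix_inv A) = column l (A ** matrix_inv A)"
    by (simp add: vec_eq_iff column_def matrix_vector_mult_def matrix_matrix_mult_def)
  then have "A *v column l (matrix_inv A) = column l (mat 1)"
    using \<open>invertible A\<close> by (simp add: matrix_inv_right)
  then have "column l (matrix_inv A) = (\<chi> k. det (\<chi> i j. if j = k then column l (mat 1) $ i else A $ i $ j) / det A)"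
    by (simp add: cramer[OF assms])
  then have "column l (matrix_inv A) $ k = det (\<chi> i j. if j = k then column l (mat 1) $ i else A $ i $ j) / det A"
    by simp
  then show ?thesis by (simp add: column_def cong: if_cong)
qed

section \<open>Derivatives of determinants and of inverse matrices\<close>

lemma has_vector_derivative_vec_nth:
  "(f has_vector_derivative D) F \<Longrightarrow> ((\<lambda>t. f t $ i) has_vector_derivative D $ i) F"
  by (rule bounded_linear.has_vector_derivative[OF bounded_linear_vec_nth])

lemma has_vector_derivative_vecI:
  fixes f :: "real \<Rightarrow> 'a::real_normed_vector^'n"
  assumes "\<And>i. ((\<lambda>t. f t $ i) has_vector_derivative D $ i) (at x within S)"
  shows "(f has_vector_derivative D) (at x within S)"
  using assms
  by (auto simp: has_vector_derivative_def has_derivative_def bounded_linear_scaleR_left intro!: vec_tendstoI)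

text \<open>The product rule in the Leibniz expansion differentiates one row at a time. This form
  also covers the numerators in Cramer's rule, which may vanish.\<close>

lemma det_has_vector_derivative_rows:
  fixes M :: "real \<Rightarrow> 'a::real_normed_field^'n^'n"
  assumes "(M has_vector_derivative D) (at x)"
  shows "((\<lambda>t. det (M t)) has_vector_derivative
           (\<Sum>k\<in>UNIV. det (\<chi> i. if i = k then D $ i else M x $ i))) (at x)"
proof -
  have "((\<lambda>t. det (M t)) has_vector_derivative
     (\<Sum>p | p permutes UNIV. of_int (sign p) * (\<Sum>k\<in>UNIV. D $ k $ p k * (\<Prod>i\<in>UNIV - {k}. M x $ i $ p i)))) (at x)"
    unfolding det_def
    by (intro has_vector_derivative_sum has_vector_derivative_mult_right has_vector_derivative_prod
          has_vector_derivative_vec_nth assms)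
  also have "(\<Sum>p | p permutes UNIV. of_int (sign p) * (\<Sum>k\<in>UNIV. D $ k $ p k * (\<Prod>i\<in>UNIV - {k}. M x $ i $ p i)))
     = (\<Sum>k\<in>UNIV. \<Sum>p | p permutes UNIV. of_int (sign p) * (D $ k $ p k * (\<Prod>i\<in>UNIV - {k}. M x $ i $ p i)))"
    by (simp only: sum_distrib_left) (rule sum.swap)
  also have "\<dots> = (\<Sum>k\<in>UNIV. det (\<chi> i. if i = k then D $ i else M x $ i))"
    unfolding det_def
  proof (intro sum.cong refl arg_cong2[where f = "(*)"])
    fix k :: 'n and p :: "'n \<Rightarrow> 'n"
    \<comment> \<open>Split off the factor \<open>i = k\<close>, the only one in which the replaced
      row occurs.\<close>
    have "(\<Prod>i\<in>UNIV. (\<chi> i. if i = k then D $ i else M x $ i) $ i $ p i) =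
      (\<chi> i. if i = k then D $ i else M x $ i) $ k $ p k *
      (\<Prod>i\<in>UNIV - {k}. (\<chi> i. if i = k then D $ i else M x $ i) $ i $ p i)"
      by (rule prod.remove) auto
    then show "D $ k $ p k * (\<Prod>i\<in>UNIV - {k}. M x $ i $ p i) =
      (\<Prod>i\<in>UNIV. (\<chi> i. if i = k then D $ i else M x $ i) $ i $ p i)"
      by simp
  qed
  finally show ?thesis .
qed

text \<open>Row \<open>k\<close> of \<open>C ** M\<close> is the combination of the rows
  \<open>M $ j\<close> with coefficients \<open>C $ k $ j\<close>. By linearity in that row only
  \<open>j = k\<close> survives, since any other \<open>j\<close> produces two equal rows.\<close>

lemma det_replace_row_mult:
  fixes C M :: "'a::comm_ring_1^'n^'n"
  shows "det (\<chi> i. if i = k then (C ** M) $ i else M $ i) = C $ k $ k * det M"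
proof -
  have "det (\<chi> i. if i = k then (C ** M) $ i else M $ i) =
        det (\<chi> i. if i = k then (\<Sum>j\<in>UNIV. C $ k $ j *s M $ j) else M $ i)"
    by (simp add: matrix_mul_sum_alt cong: if_cong)
  also have "\<dots> = (\<Sum>j\<in>UNIV. C $ k $ j * det (\<chi> i. if i = k then M $ j else M $ i))"
    by (simp add: det_linear_row_sum det_row_mul)
  also have "\<dots> = (\<Sum>j\<in>UNIV. if j = k then C $ k $ k * det M else 0)"
  proof (rule sum.cong[OF refl])
    fix j
    have "det (\<chi> i. if i = k then M $ j else M $ i) = 0" if "j \<noteq> k"
      by (rule det_identical_rows[OF that]) (use that in \<open>simp add: row_def\<close>)
    moreover have "(\<chi> i. if i = k then M $ k else M $ i) = M" by (simp add: vec_eq_iff)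
    ultimately show "C $ k $ j * det (\<chi> i. if i = k then M $ j else M $ i) =
        (if j = k then C $ k $ k * det M else 0)"
      by auto
  qed
  finally show ?thesis by simp
qed

lemma jacobi_det_formula:
  fixes M :: "real \<Rightarrow> 'a::real_normed_field^'n^'n"
  assumes "(M has_vector_derivative D) (at x)" "det (M x) \<noteq> 0"
  shows "((\<lambda>t. det (M t)) has_vector_derivative det (M x) * trace (matrix_inv (M x) ** D)) (at x)"
proof -
  have "invertible (M x)" using assms by (simp add: invertible_det_nz)
  \<comment> \<open>Each row of \<open>D\<close> becomes a linear combination of the rows of \<open>M x\<close>.\<close>
  then have "D = (D ** matrix_inv (M x)) ** M x"
    by (simp add: matrix_inv_left flip: matrix_mul_assoc)
  then have "(\<Sum>k\<in>UNIV. det (\<chi> i. if i = k then D $ i else M x $ i)) =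
     (\<Sum>k\<in>UNIV. (D ** matrix_inv (M x)) $ k $ k * det (M x))"
    by (metis (no_types) det_replace_row_mult)
  also have "\<dots> = det (M x) * trace (matrix_inv (M x) ** D)"
    by (subst trace_mul_sym) (simp add: trace_def sum_distrib_left mult.commute)
  finally show ?thesis
    using det_has_vector_derivative_rows[OF assms(1)] by simp
qed

lemma differentiable_matrix_inv:
  fixes M :: "real \<Rightarrow> 'a::real_normed_field^'n^'n"
  assumes "open I" "x \<in> I" "M differentiable (at x)" "\<And>t. t \<in> I \<Longrightarrow> det (M t) \<noteq> 0"
  shows "(\<lambda>t. matrix_inv (M t)) differentiable (at x)"
proof -
  obtain D where D: "(M has_vector_derivative D) (at x)"
    using assms(3) vector_derivative_works by blast
  have "\<exists>d. ((\<lambda>t. matrix_inv (M t) $ k $ l) has_vector_derivative d) (at x)" for k l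
  proof -
    \<comment> \<open>\<open>N t\<close> is the numerator matrix of Cramer's rule for the entry
      \<open>(k, l)\<close>. Its replaced column is constant, whence the zero column in
      \<open>E\<close>.\<close>
    define N where "N t = (\<chi> i j. if j = k then mat 1 $ i $ l else M t $ i $ j)" for t
    define E where "E = (\<chi> i j. if j = k then 0 else D $ i $ j)"
    have "(N has_vector_derivative E) (at x)"
    proof (intro has_vector_derivative_vecI)
      fix i j
      show "((\<lambda>t. N t $ i $ j) has_vector_derivative E $ i $ j) (at x)"
        using has_vector_derivative_vec_nth[OF has_vector_derivative_vec_nth[OF D], of i j]
        by (cases "j = k") (auto simp: N_def E_def)
    qed
    from det_has_vector_derivative_rows[OF this]
    have "(\<lambda>t. det (N t)) differentiable (at x)" by (rule differentiableI_vector)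
    moreover have "(\<lambda>t. det (M t)) differentiable (at x)"
      using det_has_vector_derivative_rows[OF D] by (rule differentiableI_vector)
    ultimately have "(\<lambda>t. det (N t) / det (M t)) differentiable (at x)"
      using assms(4)[OF assms(2)] by (intro differentiable_divide)
    then obtain d where "((\<lambda>t. det (N t) / det (M t)) has_vector_derivative d) (at x)"
      using vector_derivative_works by blast
    then have "((\<lambda>t. matrix_inv (M t) $ k $ l) has_vector_derivative d) (at x)"
      by (rule has_vector_derivative_transform_within_open[OF _ assms(1,2)])
         (simp add: assms(4) matrix_inv_cramer N_def)
    then show ?thesis ..
  qed
  then obtain d where "\<And>k l. ((\<lambda>t. matrix_inv (M t) $ k $ l) has_vector_derivative d k l) (at x)"
    by metis
  then have "((\<lambda>t. matrix_inv (M t)) has_vector_derivative (\<chi> k l. d k l)) (at x)"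
    by (intro has_vector_derivative_vecI) simp
  then show ?thesis by (rule differentiableI_vector)
qed

section \<open>The matrix X as a permutation of the indices\<close>

definition mode_swap :: "'m + 'm \<Rightarrow> 'm + 'm" where
  "mode_swap = case_sum Inr Inl"

lemma mode_swap_mode_swap [simp]: "mode_swap (mode_swap i) = i"
  by (cases i) (simp_all add: mode_swap_def)

lemma sum_mode_swap: "(\<Sum>i\<in>UNIV. f (mode_swap i)) = (\<Sum>i\<in>UNIV. f (i :: 'm::finite + 'm))"
  by (rule sum.reindex_bij_witness[of _ mode_swap mode_swap]) auto

text \<open>X is the permutation matrix of \<open>mode_swap\<close>. Multiplying by it from the left
  or right therefore just reindexes rows or columns, and later matrix identities are checked entry
  by entry.\<close>

lemma X_mat_nth: "X_mat $ i $ j = (if j = mode_swap i then 1 else 0)"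
  by (auto simp: X_mat_def block_mat_def mode_swap_def mat_def split: sum.splits)

lemma X_mat_mult_nth: "(X_mat ** M) $ i $ j = M $ mode_swap i $ j"
  by (simp add: matrix_matrix_mult_def X_mat_nth if_distrib[of "\<lambda>x. x * _"] cong: if_cong)

lemma mult_X_mat_nth: "(M ** X_mat) $ i $ j = M $ i $ mode_swap j"
proof -
  have "(j = mode_swap k) = (k = mode_swap j)" for k by (metis mode_swap_mode_swap)
  then show ?thesis
    by (simp add: matrix_matrix_mult_def X_mat_nth if_distrib[of "\<lambda>x. _ * x"] cong: if_cong)
qed

lemma X_mat_mult_X_mat [simp]: "X_mat ** X_mat = mat 1"
  by (simp add: vec_eq_iff X_mat_mult_nth X_mat_nth mat_def eq_commute)

section \<open>Hermitian forms and determinants of positive definite matrices\<close>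

definition herm_form :: "complex^'n^'n \<Rightarrow> complex^'n \<Rightarrow> real" where
  "herm_form A v = Re (\<Sum>i\<in>UNIV. cnj (v $ i) * (A *v v) $ i)"

lemma herm_form_add: "herm_form (A + B) v = herm_form A v + herm_form B v"
  by (simp add: herm_form_def matrix_vector_mult_add_rdistrib ring_distribs sum.distrib)

lemma herm_form_scaleR: "herm_form (c *\<^sub>R A) v = c * herm_form A v"
  by (simp add: herm_form_def matrix_vector_mult_def sum_distrib_left mult_ac scaleR_sum_right)

lemma herm_form_mat_1: "herm_form (mat 1) v = (norm v)\<^sup>2"
  by (simp add: herm_form_def norm_vec_def L2_set_def sum_nonneg cmod_power2)
    (simp add: power2_eq_square)

definition pos_def_mat :: "complex^'n^'n \<Rightarrow> bool" where
  "pos_def_mat A \<longleftrightarrow> hermitian_mat A \<and> (\<forall>v. v \<noteq> 0 \<longrightarrow> 0 < herm_form A v)"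

text \<open>Conjugation commutes with the determinant, and transposition leaves it
  unchanged.\<close>

lemma det_hermitian_mat_real:
  assumes "hermitian_mat A"
  shows "det A \<in> \<real>"
proof -
  have "cnj (det A) = det (conj_mat A)"
    by (simp add: det_def conj_mat_def)
  also have "\<dots> = det (transpose (conj_mat A))" by simp
  also have "\<dots> = det A" using assms by (simp add: hermitian_mat_def)
  finally show ?thesis by (simp add: Reals_cnj_iff)
qed

text \<open>A nonzero kernel vector would make the form vanish.\<close>

lemma det_pos_def_mat_nonzero:
  fixes A :: "complex^'n^'n"
  assumes "pos_def_mat A"
  shows "det A \<noteq> 0"
proof -
  have "x = 0" if "A *v x = 0" for x
    using assms that by (force simp: pos_def_mat_def herm_form_def)
  then have "invertible A"
    using matrix_left_invertible_ker[of A] by (simp add: invertible_left_inverse)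
  then show ?thesis by (simp add: invertible_det_nz)
qed

lemma pos_def_mat_mat_1: "pos_def_mat (mat 1)"
  by (simp add: pos_def_mat_def herm_form_mat_1)
    (auto simp: hermitian_mat_def transpose_def conj_mat_def mat_def vec_eq_iff)

lemma pos_def_mat_convex:
  assumes "pos_def_mat A" "pos_def_mat B" "0 \<le> t" "t \<le> 1"
  shows "pos_def_mat ((1 - t) *\<^sub>R A + t *\<^sub>R B)"
proof -
  have "0 < (1 - t) * herm_form A v + t * herm_form B v" if "v \<noteq> 0" for v
  proof (cases "t = 0")
    \<comment> \<open>Here \<open>t > 0\<close>, so the second summand is strictly positive; the
      first may vanish, namely at \<open>t = 1\<close>.\<close>
    case False
    have "0 < herm_form A v" "0 < herm_form B v" using assms that by (auto simp: pos_def_mat_def)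
    with False assms show ?thesis by (intro add_nonneg_pos) auto
  qed (use assms that in \<open>simp add: pos_def_mat_def\<close>)
  then show ?thesis
    using assms
    by (simp add: pos_def_mat_def herm_form_add herm_form_scaleR hermitian_mat_def
        transpose_def conj_mat_def vec_eq_iff)
qed

lemma det_pos_def_mat_pos:
  fixes A :: "complex^'n^'n"
  assumes "pos_def_mat A"
  shows "\<exists>r > 0. det A = complex_of_real r"
proof -
  define f where "f t = Re (det ((1 - t) *\<^sub>R mat 1 + t *\<^sub>R A))" for t
  \<comment> \<open>Along the segment from the identity to \<open>A\<close> the determinant is real and never vanishes.\<close>
  have path: "det ((1 - t) *\<^sub>R mat 1 + t *\<^sub>R A) = complex_of_real (f t) \<and> f t \<noteq> 0"
    if "0 \<le> t" "t \<le> 1" for t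
  proof -
    have pd: "pos_def_mat ((1 - t) *\<^sub>R mat 1 + t *\<^sub>R A)"
      by (rule pos_def_mat_convex) (use that assms pos_def_mat_mat_1 in auto)
    have "det ((1 - t) *\<^sub>R mat 1 + t *\<^sub>R A) = complex_of_real (f t)"
      using det_hermitian_mat_real pd unfolding f_def pos_def_mat_def by (metis of_real_Re)
    with det_pos_def_mat_nonzero[OF pd] show ?thesis by auto
  qed
  have "continuous_on {0..1} f"
    unfolding f_def det_def by (intro continuous_intros)
  moreover have "f 0 = 1" by (simp add: f_def)
  \<comment> \<open>If \<open>f 1\<close> were not positive, the intermediate value theorem with
    \<open>f 0 = 1\<close> would give a zero of \<open>f\<close> in \<open>{0..1}\<close>.\<close>
  ultimately have "f 1 > 0"
    using IVT2'[of f 1 0 0] path[of 1] by (cases "f 1 > 0") (force simp: not_less dest: path)+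
  then show ?thesis using path[of 1] by auto
qed

section \<open>Covariance matrices: positivity of V + 1/2 and symmetry of the adjacency
  matrix\<close>

lemma complex_covariance_X_conj:
  assumes "complex_covariance V"
  shows "V $ mode_swap i $ mode_swap j = cnj (V $ i $ j)"
  using assms unfolding complex_covariance_def
  by (auto simp: block_mat_def mode_swap_def conj_mat_def split: sum.splits)

lemma complex_covariance_hermitian:
  assumes "complex_covariance V"
  shows "hermitian_mat V"
proof -
  obtain \<Gamma> \<Delta> where *: "hermitian_mat \<Gamma>" "transpose \<Delta> = \<Delta>"
    "V = block_mat \<Gamma> \<Delta> (conj_mat \<Delta>) (conj_mat \<Gamma>)"
    using assms by (auto simp: complex_covariance_def)
  have "cnj (\<Gamma> $ j $ i) = \<Gamma> $ i $ j" "\<Delta> $ j $ i = \<Delta> $ i $ j" for i j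
    using *(1,2) by (auto simp: hermitian_mat_def transpose_def conj_mat_def vec_eq_iff)
  then show ?thesis
    unfolding *(3) hermitian_mat_def
    by (auto simp: vec_eq_iff transpose_def conj_mat_def block_mat_def split: sum.splits)
qed

text \<open>The hypothesis is the entrywise form of XBX = conj(C), and the vector on the left is w =
  X conj(v). The sum for \<open>B\<close> at w is then the complex conjugate of the sum for
  \<open>C\<close> at \<open>v\<close>, and the real parts agree.\<close>

lemma herm_form_conj_X:
  assumes "\<And>i j. B $ mode_swap i $ mode_swap j = cnj (C $ i $ j)"
  shows "herm_form B (\<chi> i. cnj (v $ mode_swap i)) = herm_form C v"
proof -
  let ?w = "\<chi> i. cnj (v $ mode_swap i)"
  have "(\<Sum>i\<in>UNIV. cnj (?w $ i) * (B *v ?w) $ i) =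
      (\<Sum>i\<in>UNIV. cnj (?w $ mode_swap i) * (B *v ?w) $ mode_swap i)"
    by (rule sum_mode_swap[symmetric])
  also have "\<dots> = (\<Sum>i\<in>UNIV. cnj (cnj (v $ i) * (C *v v) $ i))"
  proof (rule sum.cong[OF refl])
    fix i
    have "(B *v ?w) $ mode_swap i = (\<Sum>j\<in>UNIV. B $ mode_swap i $ mode_swap j * ?w $ mode_swap j)"
      unfolding matrix_vector_mult_def by (simp add: sum_mode_swap[of "\<lambda>j. B $ mode_swap i $ j * cnj (v $ mode_swap j)", symmetric])
    also have "\<dots> = cnj ((C *v v) $ i)"
      by (simp add: assms matrix_vector_mult_def)
    finally show "cnj (?w $ mode_swap i) * (B *v ?w) $ mode_swap i = cnj (cnj (v $ i) * (C *v v) $ i)"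
      by simp
  qed
  finally show ?thesis
    by (simp add: herm_form_def flip: cnj_sum)
qed

lemma complex_covariance_pos_def:
  assumes "complex_covariance V"
  shows "pos_def_mat (V + (1/2) *\<^sub>R mat 1)"
proof -
  have psd: "0 \<le> herm_form (V + (1/2) *\<^sub>R Z_mat) v" for v
    using assms by (auto simp: complex_covariance_def psd_mat_def herm_form_def)
  \<comment> \<open>XZX = -Z, as the swap exchanges the two diagonal blocks. \<open>Z_mat\<close> is
    real; the \<open>cnj\<close> matches the hypothesis of \<open>herm_form_conj_X\<close>.\<close>
  have Z: "Z_mat $ mode_swap i $ mode_swap j = - cnj (Z_mat $ i $ j)" for i j :: "'a + 'a"
    by (auto simp: Z_mat_def block_mat_def mode_swap_def mat_def split: sum.splits)
  have "herm_form (V + (1/2) *\<^sub>R Z_mat) (\<chi> i. cnj (v $ mode_swap i)) =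
        herm_form (V + (-1/2) *\<^sub>R Z_mat) v" for v
    by (rule herm_form_conj_X) (simp add: complex_covariance_X_conj[OF assms] Z)
  then have "0 \<le> herm_form (V + (-1/2) *\<^sub>R Z_mat) v" for v
    by (metis psd)
  then have "0 \<le> herm_form V v" for v
    using psd[of v] unfolding herm_form_add herm_form_scaleR by (smt (verit) mult_minus_left divide_minus_left)
  then show ?thesis
    using complex_covariance_hermitian[OF assms] pos_def_mat_mat_1
    by (auto simp: pos_def_mat_def herm_form_add herm_form_scaleR hermitian_mat_def
        transpose_def conj_mat_def vec_eq_iff intro!: add_nonneg_pos)
qed

text \<open>Write Q for V + 1/2 and R for its inverse. Hermiticity and XVX = conj(V) give
  transpose(Q) = XQX, hence R = X transpose(R) X. Multiplying by X from the left gives XR =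
  transpose(R) X = transpose(XR), so XR is symmetric, and so is X - XR.\<close>

lemma transpose_adjacency_mat:
  assumes "complex_covariance V"
  shows "transpose (adjacency_mat V) = adjacency_mat V"
proof -
  let ?Q = "V + (1/2) *\<^sub>R mat 1"
  let ?R = "matrix_inv ?Q"
  have inv: "invertible ?Q"
    using det_pos_def_mat_nonzero[OF complex_covariance_pos_def[OF assms]] by (simp add: invertible_det_nz)
  have "V $ j $ i = V $ mode_swap i $ mode_swap j" for i j
    using complex_covariance_hermitian[OF assms] complex_covariance_X_conj[OF assms, of i j]
    by (auto simp: hermitian_mat_def transpose_def conj_mat_def vec_eq_iff)
  then have "transpose V = X_mat ** V ** X_mat"
    by (simp add: vec_eq_iff transpose_def X_mat_mult_nth mult_X_mat_nth)
  then have "transpose ?Q = X_mat ** ?Q ** X_mat"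
    by (simp add: vec_eq_iff transpose_def X_mat_mult_nth mult_X_mat_nth)
       (auto simp: mat_def dest: arg_cong[of _ _ mode_swap])
  then have Q: "X_mat ** transpose ?Q ** X_mat = ?Q"
    by (simp add: matrix_mul_assoc) (simp flip: matrix_mul_assoc)
  have T: "transpose ?Q ** transpose ?R = mat 1" "transpose ?R ** transpose ?Q = mat 1"
    using matrix_inv_right[OF inv] matrix_inv_left[OF inv]
    by (simp_all flip: matrix_transpose_mul)
  \<comment> \<open>By uniqueness of the inverse it suffices that the right-hand side inverts
    \<open>?Q\<close>, rewritten as \<open>X_mat ** transpose ?Q ** X_mat\<close>; the inner factors
    X cancel.\<close>
  have "?R = X_mat ** transpose ?R ** X_mat"
  proof (rule matrix_inv_unique)
    have "(X_mat ** transpose ?Q ** X_mat) ** (X_mat ** transpose ?R ** X_mat) =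
        X_mat ** (transpose ?Q ** (X_mat ** X_mat) ** transpose ?R) ** X_mat"
      by (simp only: matrix_mul_assoc)
    then show "?Q ** (X_mat ** transpose ?R ** X_mat) = mat 1"
      unfolding Q by (simp add: T)
    have "(X_mat ** transpose ?R ** X_mat) ** (X_mat ** transpose ?Q ** X_mat) =
        X_mat ** (transpose ?R ** (X_mat ** X_mat) ** transpose ?Q) ** X_mat"
      by (simp only: matrix_mul_assoc)
    then show "(X_mat ** transpose ?R ** X_mat) ** ?Q = mat 1"
      unfolding Q by (simp add: T)
  qed
  then have "?R $ i $ j = (X_mat ** transpose ?R ** X_mat) $ i $ j" for i j by simp
  then have "?R $ i $ j = ?R $ mode_swap j $ mode_swap i" for i j
    by (simp add: X_mat_mult_nth mult_X_mat_nth transpose_def)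
  \<comment> \<open>This is the symmetry of \<open>X_mat ** ?R\<close>, written in entries.\<close>
  then have "?R $ mode_swap j $ i = ?R $ mode_swap i $ j" for i j
    by (metis mode_swap_mode_swap)
  moreover have "(mat 1 :: complex^('a + 'a)^('a + 'a)) $ mode_swap j $ i = mat 1 $ mode_swap i $ j" for i j
    by (auto simp: mat_def)
  ultimately show ?thesis
    by (simp add: adjacency_mat_def vec_eq_iff transpose_def X_mat_mult_nth)
qed

section \<open>The normalisation 1/Z and its derivative\<close>

lemma one_minus_X_adjacency_mat:
  "mat 1 - X_mat ** adjacency_mat V = matrix_inv (V + (1/2) *\<^sub>R mat 1)"
  by (simp add: adjacency_mat_def matrix_mul_assoc)

lemma det_matrix_inv:
  fixes A :: "'a::field^'n^'n"
  assumes "det A \<noteq> 0"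
  shows "det (matrix_inv A) = 1 / det A"
proof -
  have "det A * det (matrix_inv A) = det (A ** matrix_inv A)" by (simp add: det_mul)
  also have "\<dots> = 1" using assms by (simp add: matrix_inv_right invertible_det_nz)
  finally show ?thesis using assms by (simp add: field_simps)
qed

text \<open>The nonpositive reals are the branch cut of \<open>csqrt\<close>, which must be avoided
  to differentiate \<open>inv_norm\<close>. The determinant is the reciprocal of the positive real
  det(V + 1/2).\<close>

lemma det_one_minus_X_adjacency_mat:
  assumes "complex_covariance V"
  shows "det (mat 1 - X_mat ** adjacency_mat V) \<notin> \<real>\<^sub>\<le>\<^sub>0"
proof -
  obtain r where "r > 0" "det (V + (1/2) *\<^sub>R mat 1) = complex_of_real r"
    using det_pos_def_mat_pos[OF complex_covariance_pos_def[OF assms]] by blast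
  then have "det (mat 1 - X_mat ** adjacency_mat V) = complex_of_real (1 / r)"
    by (simp add: one_minus_X_adjacency_mat det_matrix_inv)
  with \<open>r > 0\<close> show ?thesis
    by (simp add: complex_nonpos_Reals_iff)
qed

text \<open>As X squares to the identity, 1 - XA factors as X(X - A). Inverting reverses the
  factors, and X is its own inverse.\<close>

lemma matrix_inv_one_minus_X:
  assumes "det (mat 1 - X_mat ** A) \<noteq> 0"
  shows "matrix_inv (mat 1 - X_mat ** A) = matrix_inv (X_mat - A) ** X_mat"
proof -
  let ?W = "matrix_inv (X_mat - A)"
  have "(X_mat ** (X_mat - A)) $ i $ j = (mat 1 - X_mat ** A) $ i $ j" for i j
    by (simp add: X_mat_mult_nth X_mat_nth mat_def eq_commute)
  then have M: "mat 1 - X_mat ** A = X_mat ** (X_mat - A)"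
    by (simp add: vec_eq_iff)
  then have "invertible (X_mat - A)"
    using assms by (auto simp: det_mul invertible_det_nz)
  note inv = matrix_inv_right[OF this] matrix_inv_left[OF this]
  have "X_mat ** (X_mat - A) ** (?W ** X_mat) = X_mat ** ((X_mat - A) ** ?W) ** X_mat"
    "?W ** X_mat ** (X_mat ** (X_mat - A)) = ?W ** (X_mat ** X_mat) ** (X_mat - A)"
    by (simp_all only: matrix_mul_assoc)
  then show ?thesis
    unfolding M by (intro matrix_inv_unique) (simp_all add: inv)
qed

lemma inv_norm_has_vector_derivative:
  assumes A: "(A has_vector_derivative A') (at x)"
    and det: "det (mat 1 - X_mat ** A x) \<notin> \<real>\<^sub>\<le>\<^sub>0"
  shows "((\<lambda>t. inv_norm (A t)) has_vector_derivative
      - (1/2) * trace (matrix_inv (X_mat - A x) ** A') * inv_norm (A x)) (at x)"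
proof -
  define M where "M t = mat 1 - X_mat ** A t" for t
  define \<tau> where "\<tau> = trace (matrix_inv (X_mat - A x) ** A')"
  have nz: "det (M x) \<noteq> 0" using det by (auto simp: M_def)
  have "(M has_vector_derivative - (X_mat ** A')) (at x)"
  proof (intro has_vector_derivative_vecI)
    fix i j
    have "((\<lambda>t. mat 1 $ i $ j - A t $ mode_swap i $ j) has_vector_derivative 0 - A' $ mode_swap i $ j) (at x)"
      by (intro has_vector_derivative_diff has_vector_derivative_const has_vector_derivative_vec_nth A)
    then show "((\<lambda>t. M t $ i $ j) has_vector_derivative (- (X_mat ** A')) $ i $ j) (at x)"
      by (simp add: M_def X_mat_mult_nth)
  qed
  from jacobi_det_formula[OF this nz]
  have "((\<lambda>t. det (M t)) has_vector_derivative
      det (M x) * trace (matrix_inv (M x) ** - (X_mat ** A'))) (at x)" .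
  also have "matrix_inv (M x) ** - (X_mat ** A') = - (matrix_inv (M x) ** (X_mat ** A'))"
    by (simp add: vec_eq_iff matrix_matrix_mult_def sum_negf)
  \<comment> \<open>The X from \<open>matrix_inv_one_minus_X\<close> meets the X from the derivative
    of \<open>M\<close>; the next step cancels them.\<close>
  also have "matrix_inv (M x) ** (X_mat ** A') = matrix_inv (X_mat - A x) ** (X_mat ** X_mat) ** A'"
    using matrix_inv_one_minus_X[of "A x"] nz by (simp add: M_def matrix_mul_assoc del: X_mat_mult_X_mat)
  also have "trace (- (matrix_inv (X_mat - A x) ** (X_mat ** X_mat) ** A')) = - \<tau>"
    by (simp add: \<tau>_def trace_def sum_negf)
  finally have "((\<lambda>t. det (M t)) has_vector_derivative det (M x) * - \<tau>) (at x)" .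
  from field_vector_diff_chain_at[OF this has_field_derivative_csqrt] det
  have "((\<lambda>t. csqrt (det (M t))) has_vector_derivative
      det (M x) * - \<tau> * inverse (2 * csqrt (det (M x)))) (at x)"
    by (simp add: M_def o_def)
  also have "det (M x) * - \<tau> * inverse (2 * csqrt (det (M x))) = - (1/2) * \<tau> * csqrt (det (M x))"
  proof -
    \<comment> \<open>The chain rule leaves the determinant divided by its square root, which is the
      square root again, so the derivative is a multiple of 1/Z itself.\<close>
    have "det (M x) = csqrt (det (M x)) * csqrt (det (M x))"
      by (simp flip: power2_eq_square)
    then have "det (M x) * inverse (csqrt (det (M x))) = csqrt (det (M x))"
      using nz by (metis (no_types) csqrt_eq_0 mult.assoc right_inverse mult.right_neutral)
    moreover have "det (M x) * - \<tau> * inverse (2 * csqrt (det (M x))) =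
        - (1/2) * \<tau> * (det (M x) * inverse (csqrt (det (M x))))"
      by simp
    ultimately show ?thesis by simp
  qed
  finally show ?thesis by (simp add: M_def inv_norm_def \<tau>_def)
qed

section \<open>Differentiability of the adjacency matrix and the final product rule\<close>

lemma differentiable_adjacency_mat:
  fixes V :: "real \<Rightarrow> complex^('m + 'm)^('m::finite + 'm)"
  assumes "open I" "\<theta> \<in> I" "V differentiable (at \<theta>)" "\<And>t. t \<in> I \<Longrightarrow> complex_covariance (V t)"
  shows "(\<lambda>t. adjacency_mat (V t)) differentiable (at \<theta>)"
proof -
  have "(\<lambda>t. matrix_inv (V t + (1/2) *\<^sub>R mat 1)) differentiable (at \<theta>)"
    by (rule differentiable_matrix_inv[OF assms(1,2)])
      (use assms(3) in \<open>auto simp: det_pos_def_mat_nonzero complex_covariance_pos_def assms(4)\<close>)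
  then obtain R' where R': "((\<lambda>t. matrix_inv (V t + (1/2) *\<^sub>R mat 1)) has_vector_derivative R') (at \<theta>)"
    using vector_derivative_works by blast
  have "((\<lambda>t. adjacency_mat (V t)) has_vector_derivative (\<chi> i j. 0 - R' $ mode_swap i $ j)) (at \<theta>)"
  proof (intro has_vector_derivative_vecI)
    fix i j
    have "((\<lambda>t. mat 1 $ mode_swap i $ j - matrix_inv (V t + (1/2) *\<^sub>R mat 1) $ mode_swap i $ j)
        has_vector_derivative 0 - R' $ mode_swap i $ j) (at \<theta>)"
      by (intro has_vector_derivative_diff has_vector_derivative_const has_vector_derivative_vec_nth R')
    then show "((\<lambda>t. adjacency_mat (V t) $ i $ j) has_vector_derivative (\<chi> i j. 0 - R' $ mode_swap i $ j) $ i $ j) (at \<theta>)"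
      by (simp add: adjacency_mat_def X_mat_mult_nth)
  qed
  then show ?thesis by (rule differentiableI_vector)
qed

theorem mainTheorem1:
  fixes V :: "real \<Rightarrow> complex^('m + 'm)^('m::finite + 'm)"
    and A :: "real \<Rightarrow> complex^('m + 'm)^('m + 'm)"
    and I :: "real set" and \<theta> :: real and n :: "'m \<Rightarrow> nat"
  assumes "open I" and "is_interval I"
    and "V differentiable_on I"
    and "\<And>t. t \<in> I \<Longrightarrow> complex_covariance (V t)"
    and "\<And>t. A t = adjacency_mat (V t)"
    and "\<theta> \<in> I"
  shows "transpose (A \<theta>) = A \<theta> \<and> A differentiable (at \<theta>) \<and>
    ((\<lambda>t. photon_prob (A t) n) has_vector_derivative
      (- (1/2) * trace (matrix_inv (X_mat - A \<theta>) ** vector_derivative A (at \<theta>))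
           * photon_prob (A \<theta>) n
       + inv_norm (A \<theta>) * (1 / (\<Prod>k\<in>UNIV. fact (n k))) * ((1/2) *
           (\<Sum>(i, j) | i \<in> rep_index (double n) \<and> j \<in> rep_index (double n) \<and> i \<noteq> j.
              vector_derivative (\<lambda>t. rep_mat (A t) i j) (at \<theta>)
              * hafnian (rep_index (double n) - {i, j}) (rep_mat (A \<theta>))))))
    (at \<theta>)"
proof (intro conjI)
  let ?S = "rep_index (double n)" and ?c = "(\<Prod>k\<in>UNIV. fact (n k)) :: complex"
  have A_eq: "A = (\<lambda>t. adjacency_mat (V t))" using assms(5) by (rule ext)
  have sym: "transpose (A t) = A t" if "t \<in> I" for t
    using transpose_adjacency_mat assms(4)[OF that] by (simp add: A_eq)
  show "transpose (A \<theta>) = A \<theta>" using sym assms(6) by simp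
  have "V differentiable (at \<theta>)"
    using assms(1,3,6) by (metis differentiable_on_def at_within_open)
  then show diff: "A differentiable (at \<theta>)"
    unfolding A_eq by (rule differentiable_adjacency_mat[OF assms(1,6) _ assms(4)])
  then have A: "(A has_vector_derivative vector_derivative A (at \<theta>)) (at \<theta>)"
    by (simp add: vector_derivative_works)
  have "((\<lambda>t. hafnian ?S (rep_mat (A t))) has_vector_derivative
      (1/2) * (\<Sum>(i, j) | i \<in> ?S \<and> j \<in> ?S \<and> i \<noteq> j.
        vector_derivative (\<lambda>t. rep_mat (A t) i j) (at \<theta>) * hafnian (?S - {i, j}) (rep_mat (A \<theta>)))) (at \<theta>)"
  proof (rule hafnian_has_vector_derivative[OF _ assms(1,6)])
    show "finite ?S" by (simp add: rep_index_def)
    show "rep_mat (A t) i j = rep_mat (A t) j i" if "t \<in> I" for t i j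
      using sym[OF that] by (simp add: rep_mat_def transpose_def vec_eq_iff)
    show "((\<lambda>t. rep_mat (A t) i j) has_vector_derivative
        vector_derivative (\<lambda>t. rep_mat (A t) i j) (at \<theta>)) (at \<theta>)" for i j
      unfolding rep_mat_def vector_derivative_works[symmetric]
      by (rule differentiableI_vector[OF has_vector_derivative_vec_nth[OF has_vector_derivative_vec_nth[OF A]]])
  qed
  \<comment> \<open>The constant \<open>1 / ?c\<close> is absorbed into the hafnian factor, so that
    the probability is a product of just two functions of the parameter.\<close>
  then have H: "((\<lambda>t. hafnian ?S (rep_mat (A t)) * (1 / ?c)) has_vector_derivative
      (1/2) * (\<Sum>(i, j) | i \<in> ?S \<and> j \<in> ?S \<and> i \<noteq> j.
        vector_derivative (\<lambda>t. rep_mat (A t) i j) (at \<theta>) * hafnian (?S - {i, j}) (rep_mat (A \<theta>))) * (1 / ?c)) (at \<theta>)"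
    by (rule has_vector_derivative_mult_left)
  have N: "((\<lambda>t. inv_norm (A t)) has_vector_derivative
      - (1/2) * trace (matrix_inv (X_mat - A \<theta>) ** vector_derivative A (at \<theta>)) * inv_norm (A \<theta>)) (at \<theta>)"
    by (rule inv_norm_has_vector_derivative[OF A])
      (simp add: A_eq det_one_minus_X_adjacency_mat assms(4,6))
  show "((\<lambda>t. photon_prob (A t) n) has_vector_derivative
      (- (1/2) * trace (matrix_inv (X_mat - A \<theta>) ** vector_derivative A (at \<theta>))
           * photon_prob (A \<theta>) n
       + inv_norm (A \<theta>) * (1 / (\<Prod>k\<in>UNIV. fact (n k))) * ((1/2) *
           (\<Sum>(i, j) | i \<in> rep_index (double n) \<and> j \<in> rep_index (double n) \<and> i \<noteq> j.
              vector_derivative (\<lambda>t. rep_mat (A t) i j) (at \<theta>)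
              * hafnian (rep_index (double n) - {i, j}) (rep_mat (A \<theta>))))))
    (at \<theta>)"
    \<comment> \<open>The product rule gives both summands; what remains is to reorder factors and
      terms.\<close>
    using has_vector_derivative_mult[OF N H]
    by (simp only: photon_prob_def divide_inverse mult_1_left mult_ac add.commute)
qed

end
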